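(* Suppose $\eta > 1$, where $\eta = \sum_{r \in \Sigma_R} p_r K_r^{-\alpha_{\min}}$. Then the skew product $F$ (with probability vector $\mathbf p$) admits no acs probability measure, i.e. there is no Borel probability measure $\mu$ on $[0,1]$ that is absolutely continuous with respect to Lebesgue measure $\lambda$ and satisfies $\sum_{j \in \Sigma} p_j\, \mu(T_j^{-1}A) = \mu(A)$ for all Borel sets $A \subseteq [0,1]$.
   Context: For $\alpha \in (0,\infty)$ let $S_\alpha : [0,1]\to[0,1]$ be given by $S_\alpha(x) = x(1+2^\alpha x^\alpha)$ if $x \in [0,\frac12]$ and $S_\alpha(x) = 2x-1$ if $x \in (\frac12,1]$. For $\alpha \in (0,\infty)$ and $K \in (0,1)$ let $R_{\alpha,K}:[0,1]\to[0,1]$ be given by $R_{\alpha,K}(x) = x(1+2^\alpha x^\alpha)$ if $x \in [0,\frac12]$ and $R_{\alpha,K}(x) = \frac12 + K(x-\frac12) + 2(1-K)(x-\frac12)^2$ if $x\in(\frac12,1]$. Let $\mathfrak S = \{S_\alpha : \alpha \in (0,\infty)\}$ and $\mathfrak R = \{R_{\alpha,K} : \alpha\in(0,\infty), K\in(0,1)\}$. Let $T_1,\ldots,T_N \in \mathfrak S \cup \mathfrak R$ be a finite collection, $\Sigma = \{1,\ldots,N\}$, $\Sigma_S = \{j \in \Sigma : T_j \in \mathfrak S\}$, $\Sigma_R = \{j\in\Sigma : T_j \in \mathfrak R\}$, and assume $\Sigma_S, \Sigma_R \neq \emptyset$. For $j \in \Sigma$ let $\alpha_j\in(0,\infty)$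 be the parameter with $T_j(x) = x(1+2^{\alpha_j}x^{\alpha_j})$ on $[0,\frac12]$; for $j \in \Sigma_R$ let $K_j \in (0,1)$ be the parameter with $T_j(x) = \frac12 + K_j(x-\frac12)+2(1-K_j)(x-\frac12)^2$ on $(\frac12,1]$. Let $\alpha_{\min} = \min\{\alpha_j : j \in \Sigma\}$; it is assumed throughout that $\alpha_{\min}<1$. Let $\mathbf p = (p_j)_{j\in\Sigma}$ be a probability vector with strictly positive entries. The skew product is $F:\Sigma^{\mathbb N}\times[0,1]\to\Sigma^{\mathbb N}\times[0,1]$, $F(\omega,x) = (\sigma\omega, T_{\omega_1}(x))$, with $\sigma$ the left shift. An acs (absolutely continuous stationary) measure for $F$ is a Borel measure $\mu$ on $[0,1]$, absolutely continuous with respect to $\lambda$, with $\sum_{j\in\Sigma} p_j\mu(T_j^{-1}A) = \mu(A)$ for all Borel $A\subseteq[0,1]$. *)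

theory Defs
  imports "HOL-Probability.Probability_Measure"
begin

text \<open>
  Maps with domain \<open>[0,1]\<close> are total functions restricted to \<open>{0..1}\<close> (they are \<open>undefined\<close>
  elsewhere), so that equality of such functions is equality as maps on \<open>[0,1]\<close>.
\<close>

definition left_branch :: "real \<Rightarrow> real \<Rightarrow> real" where
  "left_branch \<alpha> x = x * (1 + 2 powr \<alpha> * x powr \<alpha>)"

definition right_branch_R :: "real \<Rightarrow> real \<Rightarrow> real" where
  "right_branch_R K x = 1/2 + K * (x - 1/2) + 2 * (1 - K) * (x - 1/2)^2"

definition map_S :: "real \<Rightarrow> real \<Rightarrow> real" where
  "map_S \<alpha> = (\<lambda>x\<in>{0..1}. if x \<le> 1/2 then left_branch \<alpha> x else 2 * x - 1)"

definition map_R :: "real \<Rightarrow> real \<Rightarrow> real \<Rightarrow> real" where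
  "map_R \<alpha> K = (\<lambda>x\<in>{0..1}. if x \<le> 1/2 then left_branch \<alpha> x else right_branch_R K x)"

definition family_S :: "(real \<Rightarrow> real) set" where
  "family_S = {map_S \<alpha> | \<alpha>. 0 < \<alpha>}"

definition family_R :: "(real \<Rightarrow> real) set" where
  "family_R = {map_R \<alpha> K | \<alpha> K. 0 < \<alpha> \<and> 0 < K \<and> K < 1}"

definition Sigma_S :: "nat \<Rightarrow> (nat \<Rightarrow> real \<Rightarrow> real) \<Rightarrow> nat set" where
  "Sigma_S N T = {j \<in> {1..N}. T j \<in> family_S}"

definition Sigma_R :: "nat \<Rightarrow> (nat \<Rightarrow> real \<Rightarrow> real) \<Rightarrow> nat set" where
  "Sigma_R N T = {j \<in> {1..N}. T j \<in> family_R}"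

text \<open>
  Absolutely continuous stationary measures for the skew product
  \<open>F (\<omega>, x) = (\<sigma> \<omega>, T (\<omega> 1) x)\<close> with probability vector \<open>p\<close>. As usual, this is a condition
  on the fibre maps \<open>T 1, \<dots>, T N\<close> and on \<open>p\<close> only. The condition on \<open>sets \<mu>\<close> makes \<open>\<mu>\<close> a
  Borel measure with \<open>space \<mu> = {0..1}\<close>.
\<close>

definition acs_measure ::
  "nat \<Rightarrow> (nat \<Rightarrow> real \<Rightarrow> real) \<Rightarrow> (nat \<Rightarrow> real) \<Rightarrow> real measure \<Rightarrow> bool" where
  "acs_measure N T p \<mu> \<longleftrightarrow>
     sets \<mu> = sets (restrict_space borel {0..1}) \<and>
     absolutely_continuous (restrict_space lborel {0..1}) \<mu> \<and>
     (\<forall>A \<in> sets \<mu>. (\<Sum>j\<in>{1..N}. ennreal (p j) * emeasure \<mu> (T j -` A \<inter> {0..1})) = emeasure \<mu> A)"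

end

theory Submission
  imports Defs
begin

text \<open>
  Write \<open>a\<close> for the smallest exponent. Leaving \<open>[0,1/2]\<close> from \<open>x\<close> takes time of order at least
  \<open>x powr (- a)\<close>, and a map in \<open>family_S\<close> sends \<open>1/2 + y\<close> to \<open>2 * y\<close>. As in Kac's lemma, a
  stationary probability measure must therefore integrate \<open>y powr (- a)\<close> over \<open>1/2 + y > 1/2\<close>;
  this is obtained from a truncated Lyapunov function. On the other hand the maps in \<open>family_R\<close>
  contract \<open>y\<close> by about \<open>K r\<close>, so for \<open>\<eta> > 1\<close> averaging over one step strictly increases
  \<open>y powr (- a)\<close> near \<open>y = 0\<close>. For an integrable function this is only possible if the measure
  vanishes on some interval \<open>(1/2, 1/2 + \<delta>)\<close>. Almost every point can be moved into this interval by
  iterating the maps, so the whole measure vanishes.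
\<close>

section \<open>Elementary bounds for the branches\<close>

lemma left_branch_eq: "0 \<le> x \<Longrightarrow> left_branch \<alpha> x = x * (1 + (2 * x) powr \<alpha>)"
  by (simp add: left_branch_def powr_mult)

lemma left_branch_measurable [measurable]: "left_branch \<alpha> \<in> borel_measurable borel"
  unfolding left_branch_def by measurable

lemma right_branch_R_measurable [measurable]: "right_branch_R K \<in> borel_measurable borel"
  unfolding right_branch_R_def by measurable

text \<open>Since \<open>2 * x\<close> is at most 1, a smaller exponent moves points faster. Escape
  estimates made for the smallest exponent therefore serve all the maps.\<close>

lemma left_branch_le:
  assumes "0 \<le> x" "x \<le> 1/2" "a \<le> \<alpha>"
  shows "left_branch \<alpha> x \<le> left_branch a x"
proof -
  have "(2 * x) powr \<alpha> \<le> (2 * x) powr a"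
    using assms by (cases "x = 0") (auto intro!: powr_mono')
  then show ?thesis
    using assms by (simp add: left_branch_eq mult_left_mono)
qed

lemma left_branch_le_double:
  assumes "0 \<le> x" "x \<le> 1/2" "0 < \<alpha>"
  shows "left_branch \<alpha> x \<le> 2 * x"
proof -
  have "(2 * x) powr \<alpha> \<le> 1 powr \<alpha>"
    using assms by (intro powr_mono2) auto
  then have "x * (1 + (2 * x) powr \<alpha>) \<le> x * 2"
    using assms by (intro mult_left_mono) auto
  then show ?thesis
    using assms by (simp add: left_branch_eq mult.commute)
qed

lemma left_branch_pos: "0 < x \<Longrightarrow> 0 < left_branch \<alpha> x"
  by (simp add: left_branch_eq add_pos_nonneg)

lemma left_branch_nonneg: "0 \<le> x \<Longrightarrow> 0 \<le> left_branch \<alpha> x"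
  by (simp add: left_branch_eq)

text \<open>Isolates the factor by which the distance to 1/2 shrinks: it tends to \<open>K\<close>
  at 1/2 and equals 1 at the fixed point \<open>x = 1\<close>.\<close>

lemma right_branch_R_factor:
  "right_branch_R K x = 1/2 + (x - 1/2) * (K + 2 * (1 - K) * (x - 1/2))"
  by (simp add: right_branch_R_def power2_eq_square algebra_simps)

lemma right_branch_R_bounds:
  assumes "0 < K" "K < 1" "1/2 < x" "x \<le> 1"
  shows "1/2 < right_branch_R K x" "right_branch_R K x \<le> x"
proof -
  have "0 < K + 2 * (1 - K) * (x - 1/2)"
    using assms by (intro add_pos_nonneg) auto
  then show "1/2 < right_branch_R K x"
    using assms by (simp add: right_branch_R_factor)
  have "2 * (1 - K) * (x - 1/2) \<le> 2 * (1 - K) * (1/2)"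
    using assms by (intro mult_left_mono) auto
  then have "K + 2 * (1 - K) * (x - 1/2) \<le> 1"
    by simp
  then have "(x - 1/2) * (K + 2 * (1 - K) * (x - 1/2)) \<le> (x - 1/2) * 1"
    using assms by (intro mult_left_mono) simp_all
  then show "right_branch_R K x \<le> x"
    by (simp add: right_branch_R_factor)
qed

section \<open>The maps as measurable self-maps of [0,1]\<close>

lemma family_range:
  assumes "f \<in> family_S \<union> family_R" "x \<in> {0..1}"
  shows "f x \<in> {0..1}"
proof -
  have left: "left_branch \<alpha> x \<in> {0..1}" if "0 < \<alpha>" "x \<le> 1/2" for \<alpha>
    using left_branch_le_double[of x \<alpha>] left_branch_nonneg[of x \<alpha>] that assms(2) by auto
  show ?thesis
  proof (cases "x \<le> 1/2")
    case True
    then show ?thesis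
      using assms left by (auto simp: family_S_def family_R_def map_S_def map_R_def)
  next
    case False
    then have "right_branch_R K x \<in> {0..1}" if "0 < K" "K < 1" for K
      using right_branch_R_bounds[of K x] that assms(2) by auto
    then show ?thesis
      using assms False by (auto simp: family_S_def family_R_def map_S_def map_R_def)
  qed
qed

lemma family_measurable:
  assumes "f \<in> family_S \<union> family_R"
  shows "f \<in> restrict_space borel {0..1} \<rightarrow>\<^sub>M restrict_space borel {0..1}"
proof -
  \<comment> \<open>\<open>f\<close> is \<open>undefined\<close> outside [0,1], so measurability is
    transferred from a total Borel function that agrees with \<open>f\<close> on [0,1].\<close>
  obtain g where g: "g \<in> borel_measurable borel" "\<And>x. x \<in> {0..1} \<Longrightarrow> f x = g x"
  proof -
    consider \<alpha> where "f = map_S \<alpha>" | \<alpha> K where "f = map_R \<alpha> K"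
      using assms by (auto simp: family_S_def family_R_def)
    then show thesis
    proof cases
      case 1
      show thesis
        by (rule that[of "\<lambda>x. if x \<le> 1/2 then left_branch \<alpha> x else 2 * x - 1"])
           (measurable, simp add: 1 map_S_def)
    next
      case 2
      show thesis
        by (rule that[of "\<lambda>x. if x \<le> 1/2 then left_branch \<alpha> x else right_branch_R K x"])
           (measurable, simp add: 2 map_R_def)
    qed
  qed
  have "f \<in> borel_measurable (restrict_space borel {0..1})"
    using measurable_restrict_space1[OF g(1)] g(2)
    by (subst measurable_cong[where g = g]) (auto simp: space_restrict_space)
  then show ?thesis
    using family_range[OF assms] by (auto simp: measurable_restrict_space2_iff space_restrict_space)
qed

section \<open>The truncated Lyapunov function\<close>

text \<open>Bernoulli's inequality for a negative exponent, from \<open>ln (1 + t) \<le> t\<close>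
  and \<open>1 + s \<le> exp s\<close>.\<close>

lemma one_minus_le_powr:
  fixes a t :: real
  assumes "0 \<le> a" "0 \<le> t"
  shows "1 - a * t \<le> (1 + t) powr (- a)"
proof -
  have "a * ln (1 + t) \<le> a * t"
    using assms ln_add_one_self_le_self by (intro mult_left_mono) auto
  moreover have "1 + (- a * ln (1 + t)) \<le> exp (- a * ln (1 + t))"
    by (rule exp_ge_add_one_self)
  ultimately show ?thesis
    using assms by (simp add: powr_def)
qed

text \<open>
  The value \<open>0 powr (- a) = 0\<close> makes the function vanish at the common fixed point \<open>0\<close>.
\<close>

definition potential :: "real \<Rightarrow> real \<Rightarrow> real \<Rightarrow> real" where
  "potential a M x =
     (if x \<le> 1/2 then min (x powr (- a)) M
      else 2 powr (- a) / 2 * min ((x - 1/2) powr (- a)) M)"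

lemma potential_measurable [measurable]: "potential a M \<in> borel_measurable borel"
  unfolding potential_def by measurable

lemma potential_nonneg: "0 \<le> M \<Longrightarrow> 0 \<le> potential a M x"
  by (simp add: potential_def)

lemma potential_le:
  assumes "0 < a" "0 \<le> M"
  shows "potential a M x \<le> M"
proof -
  have "2 powr (- a) \<le> (1::real)"
    using assms powr_mono[of "-a" 0 "2::real"] by simp
  then have "2 powr (- a) / 2 * min ((x - 1/2) powr (- a)) M \<le> 1 * M"
    using assms by (intro mult_mono) auto
  then show ?thesis
    by (simp add: potential_def)
qed

text \<open>A step multiplies \<open>x\<close> by at most \<open>1 + (2 * x) powr a\<close>, which
  lowers \<open>x powr (- a)\<close> by at most \<open>x powr (- a) * a * (2 * x) powr a\<close>;
  here \<open>x\<close> cancels and a constant remains. Truncation preserves this, because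
  \<open>min\<close> with \<open>M\<close> is monotone and 1-Lipschitz.\<close>

lemma potential_left_branch:
  assumes "0 < a" "a \<le> \<alpha>" "0 \<le> M" "0 \<le> x" "x \<le> 1/2"
  shows "potential a M x \<le> (a * 2 powr a + 4 powr a) + potential a M (left_branch \<alpha> x)"
proof (cases "x = 0")
  case True
  then show ?thesis
    using assms by (simp add: potential_def left_branch_def)
next
  case False
  then have x: "0 < x" using assms by simp
  let ?z = "left_branch \<alpha> x"
  show ?thesis
  proof (cases "?z \<le> 1/2")
    case True
    have "x powr (- a) - a * 2 powr a = x powr (- a) * (1 - a * (2 * x) powr a)"
      using x by (simp add: powr_mult powr_minus field_simps)
    also have "\<dots> \<le> x powr (- a) * (1 + (2 * x) powr a) powr (- a)"
      using assms by (intro mult_left_mono one_minus_le_powr) auto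
    also have "\<dots> = left_branch a x powr (- a)"
      using x by (simp add: left_branch_eq powr_mult)
    also have "\<dots> \<le> ?z powr (- a)"
      using assms x left_branch_le[of x a \<alpha>] left_branch_pos[of x \<alpha>]
      by (intro powr_mono2') auto
    finally have "x powr (- a) \<le> a * 2 powr a + ?z powr (- a)"
      by simp
    moreover have "0 \<le> a * 2 powr a" "(0::real) \<le> 4 powr a"
      using assms by auto
    ultimately have "min (x powr (- a)) M \<le> (a * 2 powr a + 4 powr a) + min (?z powr (- a)) M"
      by linarith
    then show ?thesis
      using True assms by (simp add: potential_def)
  next
    case False
    \<comment> \<open>Left branches at most double a point, so 1/2 is crossed in one step only from
      [1/4,1/2], where the potential is at most \<open>4 powr a\<close>.\<close>
    then have "1/4 \<le> x"
      using left_branch_le_double[of x \<alpha>] assms by simp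
    then have "x powr (- a) \<le> (1/4) powr (- a)"
      using assms by (intro powr_mono2') auto
    then have "potential a M x \<le> 4 powr a"
      using assms by (simp add: potential_def powr_minus_divide powr_divide)
    moreover have "0 \<le> a * 2 powr a"
      using assms by simp
    ultimately show ?thesis
      using potential_nonneg[of M a ?z] assms by linarith
  qed
qed

lemma potential_antimono_right:
  assumes "0 < a" "1/2 < z" "z \<le> x"
  shows "potential a M x \<le> potential a M z"
proof -
  have "(x - 1/2) powr (- a) \<le> (z - 1/2) powr (- a)"
    using assms by (intro powr_mono2') auto
  then show ?thesis
    using assms by (auto simp: potential_def intro!: mult_left_mono)
qed

text \<open>With \<open>x = 1/2 + y\<close> the image is \<open>2 * y\<close>, and
  \<open>(2 * y) powr (- a)\<close> is twice the untruncated potential of \<open>x\<close>. The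
  bound 3/4 keeps the image in [0,1/2], where the left formula applies.\<close>

lemma potential_double:
  assumes "0 < a" "0 \<le> M" "1/2 < x" "x \<le> 3/4"
  shows "2 * potential a M x \<le> potential a M (2 * x - 1)"
proof -
  let ?y = "x - 1/2" and ?c = "2 powr (- a) :: real"
  have c: "?c \<le> 1"
    using assms powr_mono[of "-a" 0 "2::real"] by simp
  have "?c * min (?y powr (- a)) M \<le> ?c * ?y powr (- a)"
    by (intro mult_left_mono) auto
  also have "\<dots> = (2 * x - 1) powr (- a)"
    using assms by (simp flip: powr_mult add: algebra_simps)
  finally have "?c * min (?y powr (- a)) M \<le> (2 * x - 1) powr (- a)" .
  moreover have "?c * min (?y powr (- a)) M \<le> 1 * M"
    using assms c by (intro mult_mono) auto
  ultimately show ?thesis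
    using assms by (simp add: potential_def)
qed

text \<open>Covers the points whose image under \<open>2 * x - 1\<close> lies right of 1/2 again. A
  bound independent of \<open>M\<close> is enough there.\<close>

lemma potential_le_far:
  assumes "0 < a" "0 \<le> M" "3/4 < x"
  shows "potential a M x \<le> 4 powr a"
proof -
  have "(x - 1/2) powr (- a) \<le> (1/4) powr (- a)"
    using assms by (intro powr_mono2') auto
  then have "min ((x - 1/2) powr (- a)) M \<le> 4 powr a"
    by (simp add: powr_minus_divide powr_divide)
  moreover have "2 powr (- a) \<le> (1::real)"
    using assms powr_mono[of "-a" 0 "2::real"] by simp
  ultimately have "2 powr (- a) / 2 * min ((x - 1/2) powr (- a)) M \<le> 1 * 4 powr a"
    using assms by (intro mult_mono) auto
  then show ?thesis
    using assms by (simp add: potential_def)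
qed

section \<open>Consequences of stationarity\<close>

lemma acs_space: "acs_measure N T p \<mu> \<Longrightarrow> space \<mu> = {0..1}"
  using sets_eq_imp_space_eq[of \<mu> "restrict_space borel {0..1}"]
  by (simp add: acs_measure_def space_restrict_space)

text \<open>Stationarity on sets is the case of indicators; it passes to multiples, sums and
  monotone limits.\<close>

lemma acs_nn_integral:
  assumes "acs_measure N T p \<mu>"
    and T: "\<And>j. j \<in> {1..N} \<Longrightarrow> T j \<in> \<mu> \<rightarrow>\<^sub>M \<mu>"
    and "f \<in> borel_measurable \<mu>"
  shows "(\<Sum>j\<in>{1..N}. ennreal (p j) * (\<integral>\<^sup>+ x. f (T j x) \<partial>\<mu>)) = (\<integral>\<^sup>+ x. f x \<partial>\<mu>)"
  using assms(3)
proof (induct rule: borel_measurable_induct)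
  case (cong f g)
  have "(\<integral>\<^sup>+ x. f (T j x) \<partial>\<mu>) = (\<integral>\<^sup>+ x. g (T j x) \<partial>\<mu>)" if "j \<in> {1..N}" for j
    using cong(3) measurable_space[OF T[OF that]] by (intro nn_integral_cong) auto
  moreover have "(\<integral>\<^sup>+ x. f x \<partial>\<mu>) = (\<integral>\<^sup>+ x. g x \<partial>\<mu>)"
    using cong(3) by (intro nn_integral_cong) auto
  ultimately show ?case
    using cong(4) by simp
next
  case (set A)
  have sp: "space \<mu> = {0..1}"
    using assms(1) by (rule acs_space)
  have "(\<integral>\<^sup>+ x. indicator A (T j x) \<partial>\<mu>) = emeasure \<mu> (T j -` A \<inter> {0..1})" if "j \<in> {1..N}" for j
  proof -
    have "(\<integral>\<^sup>+ x. indicator A (T j x) \<partial>\<mu>) = (\<integral>\<^sup>+ x. indicator (T j -` A \<inter> {0..1}) x \<partial>\<mu>)"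
      by (intro nn_integral_cong) (auto simp: sp indicator_def)
    also have "\<dots> = emeasure \<mu> (T j -` A \<inter> {0..1})"
      using measurable_sets[OF T[OF that] set] by (simp add: sp)
    finally show ?thesis .
  qed
  then show ?case
    using assms(1) set by (simp add: acs_measure_def)
next
  case (mult u c)
  note [measurable] = mult(2)
  have "(\<integral>\<^sup>+ x. c * u (T j x) \<partial>\<mu>) = c * (\<integral>\<^sup>+ x. u (T j x) \<partial>\<mu>)" if "j \<in> {1..N}" for j
    by (intro nn_integral_cmult measurable_compose[OF T[OF that] mult(2)])
  then have "(\<Sum>j\<in>{1..N}. ennreal (p j) * (\<integral>\<^sup>+ x. c * u (T j x) \<partial>\<mu>))
      = c * (\<Sum>j\<in>{1..N}. ennreal (p j) * (\<integral>\<^sup>+ x. u (T j x) \<partial>\<mu>))"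
    unfolding sum_distrib_left by (intro sum.cong) (simp_all add: mult.left_commute)
  also have "\<dots> = (\<integral>\<^sup>+ x. c * u x \<partial>\<mu>)"
    unfolding mult(4) by (rule nn_integral_cmult[symmetric]) measurable
  finally show ?case .
next
  case (add u v)
  have "(\<integral>\<^sup>+ x. v (T j x) + u (T j x) \<partial>\<mu>) = (\<integral>\<^sup>+ x. v (T j x) \<partial>\<mu>) + (\<integral>\<^sup>+ x. u (T j x) \<partial>\<mu>)"
    if "j \<in> {1..N}" for j
    by (intro nn_integral_add measurable_compose[OF T[OF that] add(1)]
        measurable_compose[OF T[OF that] add(4)])
  then have "(\<Sum>j\<in>{1..N}. ennreal (p j) * (\<integral>\<^sup>+ x. v (T j x) + u (T j x) \<partial>\<mu>))
      = (\<Sum>j\<in>{1..N}. ennreal (p j) * (\<integral>\<^sup>+ x. v (T j x) \<partial>\<mu>))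
        + (\<Sum>j\<in>{1..N}. ennreal (p j) * (\<integral>\<^sup>+ x. u (T j x) \<partial>\<mu>))"
    unfolding sum.distrib[symmetric] by (intro sum.cong) (simp_all add: distrib_left)
  also have "\<dots> = (\<integral>\<^sup>+ x. v x + u x \<partial>\<mu>)"
    unfolding add(3) add(7) by (rule nn_integral_add[symmetric]) (fact add(4) add(1))+
  finally show ?case .
next
  case (seq U)
  note [measurable] = seq(1)
  have U: "(\<integral>\<^sup>+ x. (SUP i. U i) (T j x) \<partial>\<mu>) = (SUP i. \<integral>\<^sup>+ x. U i (T j x) \<partial>\<mu>)"
    if "j \<in> {1..N}" for j
    using T[OF that] seq(4) unfolding SUP_apply
    by (intro nn_integral_monotone_convergence_SUP) (auto simp: incseq_def le_fun_def)
  have inc: "incseq (\<lambda>i. ennreal (p j) * (\<integral>\<^sup>+ x. U i (T j x) \<partial>\<mu>))" for j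
    using seq(4) by (auto simp: incseq_def le_fun_def intro!: mult_left_mono nn_integral_mono)
  have "(\<Sum>j\<in>{1..N}. ennreal (p j) * (\<integral>\<^sup>+ x. (SUP i. U i) (T j x) \<partial>\<mu>))
      = (\<Sum>j\<in>{1..N}. SUP i. ennreal (p j) * (\<integral>\<^sup>+ x. U i (T j x) \<partial>\<mu>))"
    by (intro sum.cong) (simp_all only: U SUP_mult_left_ennreal)
  also have "\<dots> = (SUP i. \<Sum>j\<in>{1..N}. ennreal (p j) * (\<integral>\<^sup>+ x. U i (T j x) \<partial>\<mu>))"
    using inc by (intro ennreal_SUP_sum[symmetric])
  also have "\<dots> = (SUP i. \<integral>\<^sup>+ x. U i x \<partial>\<mu>)"
    by (simp only: seq(3))
  also have "\<dots> = (\<integral>\<^sup>+ x. (SUP i. U i) x \<partial>\<mu>)"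
    using seq(4) unfolding SUP_apply
    by (intro nn_integral_monotone_convergence_SUP[symmetric]) (auto simp: incseq_def le_fun_def)
  finally show ?case .
qed

text \<open>A Foster-Lyapunov bound: averaging \<open>f\<close> over one step does not change its
  integral, so integrating the drift inequality leaves only \<open>g\<close> and the constant, as
  the total mass is 1.\<close>

lemma acs_drift:
  fixes f g :: "real \<Rightarrow> real"
  assumes "prob_space \<mu>" and acs: "acs_measure N T p \<mu>"
    and T: "\<And>j. j \<in> {1..N} \<Longrightarrow> T j \<in> \<mu> \<rightarrow>\<^sub>M \<mu>"
    and p: "\<And>j. j \<in> {1..N} \<Longrightarrow> 0 \<le> p j"
    and f: "f \<in> borel_measurable \<mu>" "\<And>x. 0 \<le> f x" "(\<integral>\<^sup>+ x. ennreal (f x) \<partial>\<mu>) < \<infinity>"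
    and g: "g \<in> borel_measurable \<mu>" "\<And>x. 0 \<le> g x"
    and C: "0 \<le> C"
    and drift: "\<And>x. x \<in> {0..1} \<Longrightarrow> f x + g x \<le> C + (\<Sum>j\<in>{1..N}. p j * f (T j x))"
  shows "(\<integral>\<^sup>+ x. ennreal (g x) \<partial>\<mu>) \<le> ennreal C"
proof -
  interpret prob_space \<mu> by fact
  note [measurable] = f(1) g(1)
  have sp: "space \<mu> = {0..1}"
    using acs by (rule acs_space)
  have meas: "(\<lambda>x. ennreal (f (T j x))) \<in> borel_measurable \<mu>" if "j \<in> {1..N}" for j
    using T[OF that] by measurable
  let ?If = "\<integral>\<^sup>+ x. ennreal (f x) \<partial>\<mu>"
  have "(\<integral>\<^sup>+ x. ennreal (g x) \<partial>\<mu>) + ?If = (\<integral>\<^sup>+ x. ennreal (g x) + ennreal (f x) \<partial>\<mu>)"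
    by (subst nn_integral_add) auto
  also have "\<dots> \<le> (\<integral>\<^sup>+ x. ennreal C + (\<Sum>j\<in>{1..N}. ennreal (p j) * ennreal (f (T j x))) \<partial>\<mu>)"
  proof (intro nn_integral_mono)
    fix x assume "x \<in> space \<mu>"
    have "ennreal (g x) + ennreal (f x) = ennreal (f x + g x)"
      using f(2) g(2) by (simp add: add.commute)
    also have "\<dots> \<le> ennreal (C + (\<Sum>j\<in>{1..N}. p j * f (T j x)))"
      using drift[of x] \<open>x \<in> space \<mu>\<close> by (intro ennreal_leI) (simp add: sp)
    also have "\<dots> = ennreal C + (\<Sum>j\<in>{1..N}. ennreal (p j * f (T j x)))"
      using C f(2) p
      by (subst sum_ennreal) (auto intro!: ennreal_plus sum_nonneg mult_nonneg_nonneg)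
    also have "\<dots> = ennreal C + (\<Sum>j\<in>{1..N}. ennreal (p j) * ennreal (f (T j x)))"
      using f(2) p by (intro arg_cong2[where f = "(+)"] refl sum.cong) (simp_all add: ennreal_mult)
    finally show "ennreal (g x) + ennreal (f x)
        \<le> ennreal C + (\<Sum>j\<in>{1..N}. ennreal (p j) * ennreal (f (T j x)))" .
  qed
  also have "\<dots> = ennreal C + (\<Sum>j\<in>{1..N}. ennreal (p j) * (\<integral>\<^sup>+ x. ennreal (f (T j x)) \<partial>\<mu>))"
  proof -
    have "(\<integral>\<^sup>+ x. (\<Sum>j\<in>{1..N}. ennreal (p j) * ennreal (f (T j x))) \<partial>\<mu>)
        = (\<Sum>j\<in>{1..N}. \<integral>\<^sup>+ x. ennreal (p j) * ennreal (f (T j x)) \<partial>\<mu>)"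
      by (intro nn_integral_sum borel_measurable_times_ennreal meas) simp_all
    also have "\<dots> = (\<Sum>j\<in>{1..N}. ennreal (p j) * (\<integral>\<^sup>+ x. ennreal (f (T j x)) \<partial>\<mu>))"
      by (intro sum.cong refl nn_integral_cmult meas)
    finally show ?thesis
      by (subst nn_integral_add)
         (simp_all only: emeasure_space_1 nn_integral_const mult_1_right borel_measurable_const
           borel_measurable_sum borel_measurable_times_ennreal meas)
  qed
  also have "\<dots> = ennreal C + ?If"
    using acs_nn_integral[OF acs T, of "\<lambda>x. ennreal (f x)"] by simp
  \<comment> \<open>The integral of \<open>f\<close> is cancelled on both sides, which in
    \<open>ennreal\<close> requires that it be finite.\<close>
  finally show ?thesis
    using f(3) by auto
qed

text \<open>The measure of a null set is a sum of nonnegative terms, one for each map, so every term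
  vanishes. As \<open>p j\<close> is positive, the preimage under \<open>T j\<close> alone is null,
  and this can be iterated.\<close>

lemma acs_null_vimage_funpow:
  assumes acs: "acs_measure N T p \<mu>" and j: "j \<in> {1..N}" "T j \<in> \<mu> \<rightarrow>\<^sub>M \<mu>" "0 < p j"
    and A: "A \<in> null_sets \<mu>"
  shows "{x \<in> {0..1}. (T j ^^ n) x \<in> A} \<in> null_sets \<mu>"
proof -
  have sp: "space \<mu> = {0..1}"
    using acs by (rule acs_space)
  show ?thesis
  proof (induction n)
    case 0
    have "A \<subseteq> {0..1}"
      using A sets.sets_into_space sp by blast
    then have "{x \<in> {0..1}. (T j ^^ 0) x \<in> A} = A" by auto
    then show ?case using A by simp
  next
    case (Suc n)
    define B where "B = {x \<in> {0..1}. (T j ^^ n) x \<in> A}"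
    have B: "B \<in> sets \<mu>" "emeasure \<mu> B = 0"
      using Suc by (auto simp: B_def)
    have "(\<Sum>i\<in>{1..N}. ennreal (p i) * emeasure \<mu> (T i -` B \<inter> {0..1})) = emeasure \<mu> B"
      using acs B(1) unfolding acs_measure_def by blast
    then have "ennreal (p j) * emeasure \<mu> (T j -` B \<inter> {0..1}) = 0"
      using j(1) unfolding B(2) by (subst (asm) sum_eq_0_iff) auto
    then have "emeasure \<mu> (T j -` B \<inter> {0..1}) = 0"
      using j(3) by simp
    moreover have "T j -` B \<inter> {0..1} \<in> sets \<mu>"
      using measurable_sets[OF j(2) B(1)] by (simp add: sp)
    moreover have "T j -` B \<inter> {0..1} = {x \<in> {0..1}. (T j ^^ Suc n) x \<in> A}"
    proof (intro set_eqI)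
      fix x
      have "T j x \<in> {0..1}" if "x \<in> {0..1}"
        using measurable_space[OF j(2), of x] that by (simp only: sp)
      moreover have "(T j ^^ Suc n) x = (T j ^^ n) (T j x)"
        by (simp only: funpow_Suc_right comp_apply)
      ultimately show "x \<in> T j -` B \<inter> {0..1} \<longleftrightarrow> x \<in> {x \<in> {0..1}. (T j ^^ Suc n) x \<in> A}"
        unfolding B_def vimage_eq Int_iff mem_Collect_eq by metis
    qed
    ultimately show ?case
      by (intro null_setsI) simp_all
  qed
qed

section \<open>Orbits of a single map\<close>

text \<open>While the orbit stays in (0,1/2] it increases, so each growth factor is at least the
  initial one, \<open>q > 1\<close>. Geometric growth contradicts the bound 1/2.\<close>

lemma left_branch_escape:
  assumes T: "\<And>x. x \<in> {0..1/2} \<Longrightarrow> f x = left_branch \<alpha> x" and "0 < \<alpha>" "0 < x"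
  shows "\<exists>n. 1/2 < (f ^^ n) x"
proof (rule ccontr)
  assume "\<not> ?thesis"
  then have le: "(f ^^ n) x \<le> 1/2" for n
    by (simp add: not_less)
  define q where "q = 1 + (2 * x) powr \<alpha>"
  have q: "1 < q"
    using assms by (simp add: q_def)
  have grow: "x * q ^ n \<le> (f ^^ n) x" for n
  proof (induction n)
    case (Suc n)
    have "x * 1 \<le> x * q ^ n"
      using q assms by (intro mult_left_mono one_le_power) auto
    then have z: "x \<le> (f ^^ n) x"
      using Suc by simp
    then have "(2 * x) powr \<alpha> \<le> (2 * (f ^^ n) x) powr \<alpha>"
      using assms by (intro powr_mono2) auto
    then have "(x * q ^ n) * q \<le> (f ^^ n) x * (1 + (2 * (f ^^ n) x) powr \<alpha>)"
      using Suc q z assms by (intro mult_mono) (auto simp: q_def)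
    also have "\<dots> = f ((f ^^ n) x)"
      using le[of n] z assms by (simp add: T left_branch_eq)
    finally show ?case
      by (simp add: mult_ac)
  qed simp
  obtain n where "1 / (2 * x) < q ^ n"
    using real_arch_pow[OF q] by blast
  then have "1/2 < x * q ^ n"
    using assms by (simp add: field_simps)
  then show False
    using grow[of n] le[of n] by simp
qed

lemma right_branch_R_funpow_approach:
  assumes T: "\<And>x. x \<in> {1/2<..1} \<Longrightarrow> f x = right_branch_R K x"
    and "0 < K" "K < 1" "1/2 < x" "x < 1" "0 < \<delta>"
  shows "\<exists>n. 1/2 < (f ^^ n) x \<and> (f ^^ n) x < 1/2 + \<delta>"
proof -
  \<comment> \<open>The contraction factor at the starting point; it is below 1 because
    \<open>x\<close> is not the fixed point 1.\<close>
  define q where "q = K + 2 * (1 - K) * (x - 1/2)"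
  have "2 * (1 - K) * (x - 1/2) < 2 * (1 - K) * (1/2)"
    using assms by (intro mult_strict_left_mono) auto
  then have q1: "q < 1"
    by (simp add: q_def)
  have q0: "0 < q"
    unfolding q_def using assms by (intro add_pos_nonneg) auto
  \<comment> \<open>The lower bound keeps the orbit in the range of the right-branch formula, and
    the upper bound \<open>x\<close> keeps all later contraction factors below \<open>q\<close> or
    equal to it.\<close>
  have "1/2 < (f ^^ n) x \<and> (f ^^ n) x \<le> x \<and> (f ^^ n) x - 1/2 \<le> q ^ n" for n
  proof (induction n)
    case 0
    then show ?case using assms by auto
  next
    case (Suc n)
    let ?z = "(f ^^ n) x"
    have fz: "f ?z = right_branch_R K ?z"
      using Suc assms by (intro T) auto
    have "2 * (1 - K) * (?z - 1/2) \<le> 2 * (1 - K) * (x - 1/2)"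
      using Suc assms by (intro mult_left_mono) auto
    then have "(?z - 1/2) * (K + 2 * (1 - K) * (?z - 1/2)) \<le> q ^ n * q"
      using Suc assms q0 by (intro mult_mono) (auto simp: q_def)
    then have "f ?z - 1/2 \<le> q ^ Suc n"
      by (simp add: fz right_branch_R_factor mult.commute)
    moreover have "1/2 < f ?z" "f ?z \<le> ?z"
      using right_branch_R_bounds[of K ?z] Suc assms by (auto simp: fz)
    ultimately show ?case
      using Suc by auto
  qed
  note bounds = this
  obtain n where "q ^ n < \<delta>"
    using real_arch_pow_inv[OF \<open>0 < \<delta>\<close> q1] by blast
  then have "1/2 < (f ^^ n) x \<and> (f ^^ n) x < 1/2 + \<delta>"
    using bounds[of n] by linarith
  then show ?thesis ..
qed

lemma family_S_right: "f \<in> family_S \<Longrightarrow> x \<in> {1/2<..1} \<Longrightarrow> f x = 2 * x - 1"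
  by (auto simp: family_S_def map_S_def)

section \<open>Drift of the potential for the random system\<close>

text \<open>The smallest exponent enters as a common positive lower bound \<open>a\<close>, the form
  in which the estimates use it.\<close>

locale random_intermittent_maps =
  fixes N :: nat and T :: "nat \<Rightarrow> real \<Rightarrow> real" and \<alpha> K p :: "nat \<Rightarrow> real" and a :: real
  assumes family: "\<And>j. j \<in> {1..N} \<Longrightarrow> T j \<in> family_S \<union> family_R"
    and exponent_pos: "0 < a"
    and exponent_le: "\<And>j. j \<in> {1..N} \<Longrightarrow> a \<le> \<alpha> j"
    and left: "\<And>j x. j \<in> {1..N} \<Longrightarrow> x \<in> {0..1/2} \<Longrightarrow> T j x = left_branch (\<alpha> j) x"
    and K: "\<And>j. j \<in> Sigma_R N T \<Longrightarrow> 0 < K j \<and> K j < 1"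
    and right: "\<And>j x. j \<in> Sigma_R N T \<Longrightarrow> x \<in> {1/2<..1} \<Longrightarrow> T j x = right_branch_R (K j) x"
    and p_pos: "\<And>j. j \<in> {1..N} \<Longrightarrow> 0 < p j"
    and p_sum: "(\<Sum>j\<in>{1..N}. p j) = 1"
begin

text \<open>Maps in \<open>family_R\<close> move points closer to 1/2, while maps in
  \<open>family_S\<close> double the potential on this range.\<close>

lemma potential_le_image:
  assumes "j \<in> {1..N}" "0 \<le> M" "1/2 < x" "x \<le> 3/4"
  shows "potential a M x \<le> potential a M (T j x)"
proof (cases "j \<in> Sigma_R N T")
  case True
  then have "T j x = right_branch_R (K j) x"
    using assms by (intro right) auto
  then show ?thesis
    using right_branch_R_bounds[of "K j" x] K[OF True] assms exponent_pos
    by (simp add: potential_antimono_right)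
next
  case False
  then have "T j \<in> family_S"
    using family[OF assms(1)] assms(1) by (auto simp: Sigma_R_def)
  then have "T j x = 2 * x - 1"
    using assms by (intro family_S_right) auto
  then show ?thesis
    using potential_double[of a M x] potential_nonneg[of M a x] assms exponent_pos by simp
qed

text \<open>
  On \<open>[0,1/2]\<close> one step lowers the potential by at most a constant, since escaping from \<open>x\<close>
  takes time of order \<open>x powr (- a)\<close>. On the right the factor \<open>2 powr (- a) / 2\<close> is chosen such
  that a map in \<open>family_S\<close> at least doubles the potential, truncation included.
\<close>

lemma potential_drift:
  assumes s: "s \<in> Sigma_S N T" and M: "0 \<le> M" and x: "x \<in> {0..1}"
  shows "potential a M x + p s * (if 1/2 < x then potential a M x else 0)
    \<le> (a * 2 powr a + 2 * 4 powr a) + (\<Sum>j\<in>{1..N}. p j * potential a M (T j x))"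
proof -
  have sN: "s \<in> {1..N}" "T s \<in> family_S"
    using s by (auto simp: Sigma_S_def)
  have ps: "p s \<le> 1"
    using member_le_sum[OF sN(1), of p] p_pos p_sum by (force intro: less_imp_le)
  have C: "0 \<le> a * 2 powr a" "(0::real) \<le> 4 powr a"
    using exponent_pos by auto
  have avg: "(\<Sum>j\<in>{1..N}. p j * c) = c" for c
    using p_sum by (simp flip: sum_distrib_right)
  have nonneg: "0 \<le> (\<Sum>j\<in>{1..N}. p j * potential a M (T j x))"
    using p_pos M by (intro sum_nonneg mult_nonneg_nonneg potential_nonneg) (auto intro: less_imp_le)
  consider "x \<le> 1/2" | "1/2 < x" "x \<le> 3/4" | "3/4 < x"
    by linarith
  then show ?thesis
  proof cases
    case 1
    have "potential a M x \<le> (a * 2 powr a + 4 powr a) + potential a M (T j x)"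
      if "j \<in> {1..N}" for j
      using potential_left_branch[OF exponent_pos exponent_le[OF that] M, of x] left[OF that] 1 x
      by simp
    then have "(\<Sum>j\<in>{1..N}. p j * potential a M x)
        \<le> (\<Sum>j\<in>{1..N}. p j * (a * 2 powr a + 4 powr a) + p j * potential a M (T j x))"
      using p_pos unfolding distrib_left[symmetric]
      by (intro sum_mono mult_left_mono) (auto intro: less_imp_le)
    then have "potential a M x
        \<le> (a * 2 powr a + 4 powr a) + (\<Sum>j\<in>{1..N}. p j * potential a M (T j x))"
      unfolding avg sum.distrib .
    moreover have "p s * (if 1/2 < x then potential a M x else 0) = 0"
      using 1 by simp
    ultimately show ?thesis
      using C by linarith
  next
    case 2
    let ?u = "potential a M x"
    have "T s x = 2 * x - 1"
      using 2 sN by (intro family_S_right) auto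
    then have "2 * ?u \<le> potential a M (T s x)"
      using potential_double[of a M x] 2 M exponent_pos by simp
    \<comment> \<open>Every map keeps at least \<open>?u\<close> and the map \<open>s\<close> yields
      \<open>2 * ?u\<close>; after averaging, the surplus is \<open>p s * ?u\<close>.\<close>
    then have "?u + (if j = s then ?u else 0) \<le> potential a M (T j x)" if "j \<in> {1..N}" for j
      using potential_le_image[OF that M] 2 by auto
    then have "(\<Sum>j\<in>{1..N}. p j * (?u + (if j = s then ?u else 0)))
        \<le> (\<Sum>j\<in>{1..N}. p j * potential a M (T j x))"
      using p_pos by (intro sum_mono mult_left_mono) (auto intro: less_imp_le)
    moreover have "(\<Sum>j\<in>{1..N}. p j * (?u + (if j = s then ?u else 0))) = ?u + p s * ?u"
    proof -
      have "(\<Sum>j\<in>{1..N}. p j * (if j = s then ?u else 0)) = (\<Sum>j\<in>{1..N}. if j = s then p j * ?u else 0)"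
        by (intro sum.cong) auto
      also have "\<dots> = p s * ?u"
        using sN(1) by (subst sum.delta) auto
      finally show ?thesis
        unfolding distrib_left sum.distrib avg by simp
    qed
    ultimately have "?u + p s * ?u \<le> (\<Sum>j\<in>{1..N}. p j * potential a M (T j x))"
      by simp
    moreover have "p s * (if 1/2 < x then ?u else 0) = p s * ?u"
      using 2 by simp
    ultimately show ?thesis
      using C by linarith
  next
    case 3
    \<comment> \<open>Both terms on the left are at most \<open>4 powr a\<close>, whence the factor
      2 in the constant.\<close>
    have u: "potential a M x \<le> 4 powr a"
      using 3 M exponent_pos by (intro potential_le_far) auto
    have "p s * potential a M x \<le> 1 * 4 powr a"
      using ps u M potential_nonneg by (intro mult_mono) auto
    moreover have "p s * (if 1/2 < x then potential a M x else 0) = p s * potential a M x"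
      using 3 by simp
    ultimately show ?thesis
      using C(1) u nonneg by linarith
  qed
qed

lemma maps_measurable:
  assumes "acs_measure N T p \<mu>" "j \<in> {1..N}"
  shows "T j \<in> \<mu> \<rightarrow>\<^sub>M \<mu>"
  using family_measurable[OF family[OF assms(2)]] assms(1) unfolding acs_measure_def
  by (simp cong: measurable_cong_sets)

lemma borel_measurable_acs:
  assumes "acs_measure N T p \<mu>" "f \<in> borel_measurable borel"
  shows "f \<in> borel_measurable \<mu>"
  using measurable_restrict_space1[OF assms(2)] assms(1) unfolding acs_measure_def
  by (simp cong: measurable_cong_sets)

section \<open>Integrability of the singularity at 1/2\<close>

text \<open>The drift bound is uniform in the truncation level, so monotone convergence removes the
  truncation.\<close>

lemma singularity_nn_integral_finite:
  assumes \<mu>: "prob_space \<mu>" "acs_measure N T p \<mu>" and s: "s \<in> Sigma_S N T"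
  shows "(\<integral>\<^sup>+ x. ennreal (if 1/2 < x then (x - 1/2) powr (- a) else 0) \<partial>\<mu>) < \<infinity>"
proof -
  interpret prob_space \<mu> by fact
  have ps: "0 < p s"
    using p_pos s by (auto simp: Sigma_S_def)
  \<comment> \<open>Chosen so that \<open>c * min (w x) (real n)\<close> is exactly the surplus term
    of \<open>potential_drift\<close> at truncation level \<open>n\<close>.\<close>
  define c where "c = p s * (2 powr (- a) / 2)"
  have c: "0 < c"
    using ps by (simp add: c_def)
  define w where "w x = (if 1/2 < x then (x - 1/2) powr (- a) else 0)" for x :: real
  have w [measurable]: "w \<in> borel_measurable borel"
    unfolding w_def by measurable
  have w0: "0 \<le> w x" for x
    by (simp add: w_def)
  define C where "C = a * 2 powr a + 2 * 4 powr a"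
  have bound: "(\<integral>\<^sup>+ x. ennreal (c * min (w x) (real n)) \<partial>\<mu>) \<le> ennreal C" for n
  proof (rule acs_drift[OF \<mu>])
    show "T j \<in> \<mu> \<rightarrow>\<^sub>M \<mu>" "0 \<le> p j" if "j \<in> {1..N}" for j
      using that maps_measurable[OF \<mu>(2)] p_pos[OF that] by auto
    show "potential a (real n) \<in> borel_measurable \<mu>"
      by (intro borel_measurable_acs[OF \<mu>(2)]) measurable
    show "(\<lambda>x. c * min (w x) (real n)) \<in> borel_measurable \<mu>"
      by (intro borel_measurable_acs[OF \<mu>(2)]) measurable
    show "0 \<le> potential a (real n) x" "0 \<le> c * min (w x) (real n)" for x
      using c w0 by (auto simp: potential_nonneg)
    \<comment> \<open>Truncation is what makes the potential integrable in advance, so that the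
      drift lemma applies.\<close>
    have "(\<integral>\<^sup>+ x. ennreal (potential a (real n) x) \<partial>\<mu>) \<le> (\<integral>\<^sup>+ x. ennreal (real n) \<partial>\<mu>)"
      using exponent_pos by (intro nn_integral_mono ennreal_leI potential_le) auto
    also have "\<dots> < \<infinity>"
      by (simp add: emeasure_space_1)
    finally show "(\<integral>\<^sup>+ x. ennreal (potential a (real n) x) \<partial>\<mu>) < \<infinity>" .
    show "0 \<le> C"
      using exponent_pos by (simp add: C_def)
    fix x :: real assume "x \<in> {0..1}"
    moreover have "c * min (w x) (real n) = p s * (if 1/2 < x then potential a (real n) x else 0)"
      by (simp add: c_def w_def potential_def)
    ultimately show "potential a (real n) x + c * min (w x) (real n)
        \<le> C + (\<Sum>j\<in>{1..N}. p j * potential a (real n) (T j x))"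
      using potential_drift[OF s, of "real n" x] by (simp add: C_def)
  qed
  have "(SUP n. ennreal (c * min (w x) (real n))) = ennreal (c * w x)" for x
  proof (rule antisym)
    show "(SUP n. ennreal (c * min (w x) (real n))) \<le> ennreal (c * w x)"
      using c by (intro SUP_least ennreal_leI mult_left_mono) auto
    obtain n where "w x \<le> real n"
      using real_arch_simple by blast
    then show "ennreal (c * w x) \<le> (SUP n. ennreal (c * min (w x) (real n)))"
      by (intro SUP_upper2[of n]) (auto simp: min_def)
  qed
  then have "(\<integral>\<^sup>+ x. ennreal (c * w x) \<partial>\<mu>) = (\<integral>\<^sup>+ x. (SUP n. ennreal (c * min (w x) (real n))) \<partial>\<mu>)"
    by simp
  also have "\<dots> = (SUP n. \<integral>\<^sup>+ x. ennreal (c * min (w x) (real n)) \<partial>\<mu>)"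
  proof (intro nn_integral_monotone_convergence_SUP)
    show "incseq (\<lambda>n x. ennreal (c * min (w x) (real n)))"
      using c by (auto simp: incseq_def le_fun_def intro!: ennreal_leI mult_left_mono)
    show "(\<lambda>x. ennreal (c * min (w x) (real n))) \<in> borel_measurable \<mu>" for n
      by (intro borel_measurable_acs[OF \<mu>(2)]) measurable
  qed
  also have "\<dots> \<le> ennreal C"
    by (intro SUP_least bound)
  finally have "(\<integral>\<^sup>+ x. ennreal (c * w x) \<partial>\<mu>) \<le> ennreal C" .
  moreover have "(\<integral>\<^sup>+ x. ennreal (c * w x) \<partial>\<mu>) = ennreal c * (\<integral>\<^sup>+ x. ennreal (w x) \<partial>\<mu>)"
    using c w0 borel_measurable_acs[OF \<mu>(2) w]
    by (simp add: ennreal_mult' nn_integral_cmult)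
  ultimately have "ennreal c * (\<integral>\<^sup>+ x. ennreal (w x) \<partial>\<mu>) < \<infinity>"
    using le_less_trans[of _ "ennreal C" \<infinity>] by simp
  then have "(\<integral>\<^sup>+ x. ennreal (w x) \<partial>\<mu>) < \<infinity>"
    using c by (auto simp: ennreal_mult_less_top top_unique less_top)
  then show ?thesis
    by (simp only: w_def)
qed

section \<open>Vanishing of the measure just right of 1/2\<close>

text \<open>By continuity at 0 the strict inequality survives when \<open>K r\<close> is replaced by
  the largest contraction factor on (1/2, 1/2 + \<delta>]. The bound \<delta> < 1/2 keeps this
  interval inside [0,1].\<close>

lemma perturbed_contraction_average:
  assumes "1 < (\<Sum>r\<in>Sigma_R N T. p r * K r powr (- a))"
  obtains \<delta> where "0 < \<delta>" "\<delta> < 1/2"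
    "1 < (\<Sum>r\<in>Sigma_R N T. p r * (K r + 2 * (1 - K r) * \<delta>) powr (- a))"
proof -
  let ?f = "\<lambda>\<delta>. \<Sum>r\<in>Sigma_R N T. p r * (K r + 2 * (1 - K r) * \<delta>) powr (- a)"
  have "(?f \<longlongrightarrow> ?f 0) (at_right 0)"
    using K by (intro tendsto_intros) force+
  then have "eventually (\<lambda>\<delta>. 1 < ?f \<delta>) (at_right 0)"
    using assms by (intro order_tendstoD(1)[where y = "?f 0"]) auto
  moreover have "eventually (\<lambda>\<delta>::real. \<delta> \<in> {0<..<1/2}) (at_right 0)"
    by (intro eventually_at_right_real) simp
  ultimately have "eventually (\<lambda>\<delta>. 1 < ?f \<delta> \<and> \<delta> \<in> {0<..<1/2}) (at_right 0)"
    by (rule eventually_conj)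
  then obtain \<delta> where "1 < ?f \<delta>" "\<delta> \<in> {0<..<1/2}"
    using eventually_happens trivial_limit_at_right_real by blast
  then show thesis
    by (intro that) auto
qed

text \<open>
  The function \<open>\<phi>\<close> below is a finite-mean subsolution: averaging over one step never decreases
  it, and increases it near \<open>1/2\<close> because the contractions overcompensate.
\<close>

lemma null_right_of_half:
  assumes \<mu>: "prob_space \<mu>" "acs_measure N T p \<mu>" and s: "s \<in> Sigma_S N T"
    and supercritical: "1 < (\<Sum>r\<in>Sigma_R N T. p r * K r powr (- a))"
  obtains \<delta> where "0 < \<delta>" "{1/2<..<1/2 + \<delta>} \<in> null_sets \<mu>"
proof -
  obtain \<delta> where \<delta>: "0 < \<delta>" "\<delta> < 1/2"
    and avg: "1 < (\<Sum>r\<in>Sigma_R N T. p r * (K r + 2 * (1 - K r) * \<delta>) powr (- a))"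
    using perturbed_contraction_average[OF supercritical] .
  define \<theta> where "\<theta> = (\<Sum>r\<in>Sigma_R N T. p r * (K r + 2 * (1 - K r) * \<delta>) powr (- a))"
  \<comment> \<open>Subtracting \<open>\<delta> powr (- a)\<close> confines the support of
    \<open>\<phi>\<close> to the interval on which the maps in \<open>family_R\<close> are
    controlled.\<close>
  define \<phi> where "\<phi> x = (if 1/2 < x then max ((x - 1/2) powr (- a) - \<delta> powr (- a)) 0 else 0)" for x
  define g where "g x = (if 1/2 < x \<and> x < 1/2 + \<delta> then (\<theta> - 1) * \<delta> powr (- a) else 0)" for x
  have R: "Sigma_R N T \<subseteq> {1..N}" "finite (Sigma_R N T)"
    by (auto simp: Sigma_R_def)
  have pR: "(\<Sum>r\<in>Sigma_R N T. p r) \<le> 1"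
    using p_pos p_sum sum_mono2[OF _ R(1), of p] by (auto intro: less_imp_le)
  have \<theta>: "1 < \<theta>"
    using avg by (simp add: \<theta>_def)
  have \<phi>_meas: "\<phi> \<in> borel_measurable borel"
    unfolding \<phi>_def by measurable
  have g_meas: "g \<in> borel_measurable borel"
    unfolding g_def by measurable
  have \<phi>0: "0 \<le> \<phi> x" for x
    by (simp add: \<phi>_def)
  \<comment> \<open>The drift inequality holds with constant 0, which forces the nonnegative gain
    \<open>g\<close> to vanish almost everywhere.\<close>
  have "(\<integral>\<^sup>+ x. ennreal (g x) \<partial>\<mu>) \<le> ennreal 0"
  proof (rule acs_drift[OF \<mu>])
    show "T j \<in> \<mu> \<rightarrow>\<^sub>M \<mu>" "0 \<le> p j" if "j \<in> {1..N}" for j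
      using that maps_measurable[OF \<mu>(2)] p_pos[OF that] by auto
    show "\<phi> \<in> borel_measurable \<mu>" "g \<in> borel_measurable \<mu>"
      by (intro borel_measurable_acs[OF \<mu>(2)] \<phi>_meas g_meas)+
    show "0 \<le> \<phi> x" "0 \<le> g x" for x
      using \<theta> by (auto simp: \<phi>0 g_def)
    have "(\<integral>\<^sup>+ x. ennreal (\<phi> x) \<partial>\<mu>)
        \<le> (\<integral>\<^sup>+ x. ennreal (if 1/2 < x then (x - 1/2) powr (- a) else 0) \<partial>\<mu>)"
      by (intro nn_integral_mono ennreal_leI) (simp add: \<phi>_def)
    also have "\<dots> < \<infinity>"
      by (rule singularity_nn_integral_finite[OF \<mu> s])
    finally show "(\<integral>\<^sup>+ x. ennreal (\<phi> x) \<partial>\<mu>) < \<infinity>" .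
    fix x :: real assume "x \<in> {0..1}"
    show "\<phi> x + g x \<le> 0 + (\<Sum>j\<in>{1..N}. p j * \<phi> (T j x))"
    proof (cases "1/2 < x \<and> x < 1/2 + \<delta>")
      case False
      then have "\<phi> x = 0"
        using \<delta> exponent_pos powr_mono2'[of "- a" \<delta> "x - 1/2"] by (auto simp: \<phi>_def)
      moreover have "0 \<le> (\<Sum>j\<in>{1..N}. p j * \<phi> (T j x))"
        using p_pos \<phi>0 by (intro sum_nonneg mult_nonneg_nonneg) (auto intro: less_imp_le)
      moreover have "g x = 0"
        using False by (auto simp: g_def)
      ultimately show ?thesis
        by simp
    next
      case True
      define y where "y = x - 1/2"
      have y: "0 < y" "y < \<delta>" "x = 1/2 + y"
        using True by (auto simp: y_def)
      have y\<delta>: "\<delta> powr (- a) \<le> y powr (- a)"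
        using y exponent_pos by (intro powr_mono2') auto
      have step: "(K r + 2 * (1 - K r) * \<delta>) powr (- a) * y powr (- a) - \<delta> powr (- a) \<le> \<phi> (T r x)"
        if r: "r \<in> Sigma_R N T" for r
      proof -
        have Tr: "T r x = 1/2 + y * (K r + 2 * (1 - K r) * y)"
          using right[OF r, of x] y \<delta> by (simp add: right_branch_R_factor)
        have "2 * (1 - K r) * y \<le> 2 * (1 - K r) * \<delta>"
          using K[OF r] y by (intro mult_left_mono) auto
        then have "y * (K r + 2 * (1 - K r) * y) \<le> y * (K r + 2 * (1 - K r) * \<delta>)"
          using y by (intro mult_left_mono) auto
        moreover have pos: "0 < y * (K r + 2 * (1 - K r) * y)"
          using K[OF r] y by (intro mult_pos_pos add_pos_nonneg) auto
        ultimately have "(y * (K r + 2 * (1 - K r) * \<delta>)) powr (- a)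
            \<le> (y * (K r + 2 * (1 - K r) * y)) powr (- a)"
          using exponent_pos by (intro powr_mono2') auto
        also have "(y * (K r + 2 * (1 - K r) * \<delta>)) powr (- a)
            = (K r + 2 * (1 - K r) * \<delta>) powr (- a) * y powr (- a)"
          using K[OF r] y \<delta> by (subst powr_mult) (auto simp: mult.commute)
        finally have "(K r + 2 * (1 - K r) * \<delta>) powr (- a) * y powr (- a)
            \<le> (T r x - 1/2) powr (- a)"
          by (simp add: Tr)
        moreover have "1/2 < T r x"
          using pos by (simp add: Tr)
        ultimately show ?thesis
          by (simp add: \<phi>_def)
      qed
      \<comment> \<open>The weights on \<open>Sigma_R\<close> sum to at most 1, so the subtracted
        constant costs at most \<open>\<delta> powr (- a)\<close> on average. The remaining maps
        contribute nonnegative terms.\<close>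
      have "\<theta> * y powr (- a) - \<delta> powr (- a)
          \<le> \<theta> * y powr (- a) - (\<Sum>r\<in>Sigma_R N T. p r) * \<delta> powr (- a)"
        using mult_right_mono[OF pR, of "\<delta> powr (- a)"] by simp
      also have "\<dots> = (\<Sum>r\<in>Sigma_R N T.
          p r * ((K r + 2 * (1 - K r) * \<delta>) powr (- a) * y powr (- a) - \<delta> powr (- a)))"
        by (simp add: \<theta>_def sum_distrib_right sum_subtractf right_diff_distrib mult.assoc)
      also have "\<dots> \<le> (\<Sum>r\<in>Sigma_R N T. p r * \<phi> (T r x))"
        using p_pos R step by (intro sum_mono mult_left_mono) (auto intro!: less_imp_le)
      also have "\<dots> \<le> (\<Sum>j\<in>{1..N}. p j * \<phi> (T j x))"
        using R(1) by (intro sum_mono2 mult_nonneg_nonneg) (auto intro: \<phi>0 less_imp_le[OF p_pos])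
      finally have "\<theta> * y powr (- a) - \<delta> powr (- a) \<le> (\<Sum>j\<in>{1..N}. p j * \<phi> (T j x))" .
      \<comment> \<open>The average exceeds \<open>\<phi> x\<close> by at least
        \<open>(\<theta> - 1) * y powr (- a)\<close>, which dominates the constant value of
        \<open>g\<close> on the interval.\<close>
      moreover have "(\<theta> - 1) * \<delta> powr (- a) \<le> (\<theta> - 1) * y powr (- a)"
        using \<theta> y\<delta> by (intro mult_left_mono) auto
      ultimately show ?thesis
        using True y\<delta> by (simp add: \<phi>_def g_def y_def left_diff_distrib)
    qed
  qed simp
  then have "AE x in \<mu>. ennreal (g x) = 0"
    using borel_measurable_acs[OF \<mu>(2) g_meas] by (subst (asm) ennreal_0) (simp add: nn_integral_0_iff_AE)
  then have "AE x in \<mu>. x \<notin> {1/2<..<1/2 + \<delta>}"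
    by eventually_elim (use \<theta> \<delta> in \<open>auto simp: g_def ennreal_eq_0_iff mult_le_0_iff\<close>)
  moreover have "{1/2<..<1/2 + \<delta>} \<in> sets \<mu>"
    using \<mu>(2) \<delta> by (auto simp: acs_measure_def sets_restrict_space_iff)
  ultimately have "{1/2<..<1/2 + \<delta>} \<in> null_sets \<mu>"
    by (simp add: AE_iff_null_sets)
  then show thesis
    using \<delta>(1) by (intro that)
qed

section \<open>Spreading the null interval over [0,1]\<close>

text \<open>One map in \<open>family_R\<close> suffices: it brings (1/2,1) into the null interval
  and (0,1/2] into (1/2,1]. Pulling null sets back twice leaves only the fixed points 0 and
  1.\<close>

theorem no_acs_prob_space:
  assumes \<mu>: "prob_space \<mu>" "acs_measure N T p \<mu>"
    and s: "s \<in> Sigma_S N T"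
    and supercritical: "1 < (\<Sum>r\<in>Sigma_R N T. p r * K r powr (- a))"
  shows False
proof -
  interpret prob_space \<mu> by fact
  obtain \<delta> where \<delta>: "0 < \<delta>" "{1/2<..<1/2 + \<delta>} \<in> null_sets \<mu>"
    using null_right_of_half[OF \<mu> s supercritical] .
  \<comment> \<open>Absolute continuity enters here. It excludes the point masses at 0 and 1, which
    are stationary themselves.\<close>
  have point: "{x} \<in> null_sets \<mu>" if "x \<in> {0..1}" for x
  proof -
    have "{x} \<in> null_sets (restrict_space lborel {0..1})"
      using that by (simp add: null_sets_restrict_space finite_imp_null_set_lborel)
    then show ?thesis
      using \<mu>(2) by (auto simp: acs_measure_def absolutely_continuous_def)
  qed
  have "Sigma_R N T \<noteq> {}"
    using supercritical by auto
  then obtain r where r: "r \<in> Sigma_R N T" "r \<in> {1..N}"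
    by (auto simp: Sigma_R_def)
  have "(\<Union>n. {x \<in> {0..1}. (T r ^^ n) x \<in> {1/2<..<1/2 + \<delta>}}) \<in> null_sets \<mu>"
    by (intro null_sets_UN acs_null_vimage_funpow[OF \<mu>(2)] maps_measurable[OF \<mu>(2)] r p_pos \<delta>)
  then have null: "(\<Union>n. {x \<in> {0..1}. (T r ^^ n) x \<in> {1/2<..<1/2 + \<delta>}}) \<union> {1} \<in> null_sets \<mu>"
    using point[of 1] by (intro null_sets.Un) auto
  have "{1/2<..1} \<in> null_sets \<mu>"
  proof (rule null_sets_subset[OF null])
    show "{1/2<..1} \<in> sets \<mu>"
      using \<mu>(2) by (auto simp: acs_measure_def sets_restrict_space_iff)
    show "{1/2<..1} \<subseteq> (\<Union>n. {x \<in> {0..1}. (T r ^^ n) x \<in> {1/2<..<1/2 + \<delta>}}) \<union> {1}"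
    proof
      fix x :: real assume x: "x \<in> {1/2<..1}"
      show "x \<in> (\<Union>n. {x \<in> {0..1}. (T r ^^ n) x \<in> {1/2<..<1/2 + \<delta>}}) \<union> {1}"
      proof (cases "x = 1")
        case False
        then show ?thesis
          using right_branch_R_funpow_approach[OF right[OF r(1)], of x \<delta>] K[OF r(1)] x \<delta>(1) by auto
      qed simp
    qed
  qed
  then have "(\<Union>n. {x \<in> {0..1}. (T r ^^ n) x \<in> {1/2<..1}}) \<in> null_sets \<mu>"
    by (intro null_sets_UN acs_null_vimage_funpow[OF \<mu>(2)] maps_measurable[OF \<mu>(2)] r p_pos)
  then have null: "(\<Union>n. {x \<in> {0..1}. (T r ^^ n) x \<in> {1/2<..1}}) \<union> {0} \<in> null_sets \<mu>"
    using point[of 0] by (intro null_sets.Un) auto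
  have "space \<mu> \<in> null_sets \<mu>"
  proof (rule null_sets_subset[OF null sets.top], rule)
    fix x assume "x \<in> space \<mu>"
    then have x: "x \<in> {0..1}"
      by (simp add: acs_space[OF \<mu>(2)])
    show "x \<in> (\<Union>n. {x \<in> {0..1}. (T r ^^ n) x \<in> {1/2<..1}}) \<union> {0}"
    proof (cases "x = 0")
      case False
      have "0 < \<alpha> r"
        using exponent_pos exponent_le[OF r(2)] by simp
      then obtain n where n: "1/2 < (T r ^^ n) x"
        using left_branch_escape[OF left[OF r(2)], of x] False x by auto
      have "(T r ^^ n) x \<in> {0..1}"
        using x by (induction n) (use family_range[OF family[OF r(2)]] in auto)
      then show ?thesis
        using n x by auto
    qed simp
  qed
  then show False
    using emeasure_space_1 by auto
qed

end

theorem theorem1p1: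
  fixes N :: nat
    and T :: "nat \<Rightarrow> real \<Rightarrow> real"
    and \<alpha> K p :: "nat \<Rightarrow> real"
    and \<alpha>_min \<eta> :: real
  assumes "\<And>j. j \<in> {1..N} \<Longrightarrow> T j \<in> family_S \<union> family_R"
    and "Sigma_S N T \<noteq> {}"
    and "Sigma_R N T \<noteq> {}"
    and "\<And>j. j \<in> {1..N} \<Longrightarrow> 0 < \<alpha> j"
    and "\<And>j x. j \<in> {1..N} \<Longrightarrow> x \<in> {0..1/2} \<Longrightarrow> T j x = left_branch (\<alpha> j) x"
    and "\<And>j. j \<in> Sigma_R N T \<Longrightarrow> 0 < K j \<and> K j < 1"
    and "\<And>j x. j \<in> Sigma_R N T \<Longrightarrow> x \<in> {1/2<..1} \<Longrightarrow> T j x = right_branch_R (K j) x"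
    and "\<alpha>_min = Min (\<alpha> ` {1..N})"
    and "\<alpha>_min < 1"
    and "\<And>j. j \<in> {1..N} \<Longrightarrow> 0 < p j"
    and "(\<Sum>j\<in>{1..N}. p j) = 1"
    and "\<eta> = (\<Sum>r\<in>Sigma_R N T. p r * K r powr (- \<alpha>_min))"
    and "\<eta> > 1"
  shows "\<not> (\<exists>\<mu>. prob_space \<mu> \<and> acs_measure N T p \<mu>)"
proof -
  obtain s where s: "s \<in> Sigma_S N T"
    using assms(2) by blast
  then have ne: "\<alpha> ` {1..N} \<noteq> {}"
    by (auto simp: Sigma_S_def)
  have "\<alpha>_min \<in> \<alpha> ` {1..N}"
    unfolding assms(8) using ne by (intro Min_in) auto
  then have pos: "0 < \<alpha>_min"
    using assms(4) by auto
  have le: "\<alpha>_min \<le> \<alpha> j" if "j \<in> {1..N}" for j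
    unfolding assms(8) using that by (intro Min_le) auto
  interpret random_intermittent_maps N T \<alpha> K p \<alpha>_min
    by unfold_locales (fact pos le assms)+
  show ?thesis
    using no_acs_prob_space[OF _ _ s] assms(12,13) by blast
qed

end
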